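(* Let $N,N'$ be integers with $2\le N'\le N-2$. The lower triangular matrix $H=(h_{k,j})\in\mathbb{R}^{(N-1)\times(N-1)}$ with nonzero diagonal entries whose Q-functions are $$Q(N-1,k,j)=\begin{cases}\frac1{k+1}\binom{N-j-1}{k-1} & \text{for } j=1,\dots,N'-1,\\[1mm] \frac{j-N'+1}{N-N'+1}\binom{N-j-1}{k-1} & \text{for } j=N',\dots,N-1,\end{cases}\qquad k=1,\dots,N-j,$$ is given, for $1\le j\le k\le N-1$, by $$h_{k,j}=\begin{cases}\frac{N-k}{N-k+1} & \text{for } j=k\le N'-1,\\[1mm] -\frac{N-k}{(N-j)(N-j+1)} & \text{for } j<k\le N'-1,\\[1mm] \frac{k-N'+1}{k-N'+2} & \text{for } j=k\ge N',\\[1mm] -\frac{j-N'+1}{(k-N'+1)(k-N'+2)} & \text{for } N'\le j<k,\\[1mm] -\frac{N-N'+1}{2(N-j)(N-j+1)} & \text{for } k\ge N',\ j\le N'-1.\end{cases}$$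
   Context: For a lower triangular $H=(h_{i,j})\in\mathbb{R}^{(N-1)\times(N-1)}$ define for $m,j\in\{1,\dots,N-1\}$ $$Q(N-1,m,j)=\sum_{j=j(1)\le i(1)<j(2)\le i(2)<\cdots<j(m)\le i(m)\le N-1}\ \prod_{r=1}^m h_{i(r),j(r)}$$ (empty sums are $0$). The map sending a lower triangular $H$ with nonzero diagonal entries to $(Q(N-1,k,j))_{1\le j\le N-1,\,1\le k\le N-j}$ is one-to-one onto the families with $Q(N-1,N-j,j)\ne0$ for all $j$. *)

theory Defs
  imports Complex_Main "HOL-Library.FuncSet" "Jordan_Normal_Form.Matrix"
begin

text \<open>Matrices are indexed from 0 in the library; \<open>entry H k j\<close> is $h_{k,j}$ with
  indices starting at 1, and is only used for $k, j \ge 1$.\<close>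

definition entry :: "real mat \<Rightarrow> nat \<Rightarrow> nat \<Rightarrow> real" where
  "entry H k j = H $$ (k - 1, j - 1)"

definition lower_triangular_nz :: "nat \<Rightarrow> real mat \<Rightarrow> bool" where
  "lower_triangular_nz n H \<longleftrightarrow>
     H \<in> carrier_mat n n \<and> upper_triangular (transpose_mat H) \<and>
     (\<forall>j\<in>{1..n}. entry H j j \<noteq> 0)"

text \<open>\<open>Q_indices n m j\<close> is the set of pairs of index sequences $(i(r))_{r=1}^m$, $(j(r))_{r=1}^m$
  with $j = j(1) \le i(1) < j(2) \le i(2) < \dots < j(m) \le i(m) \le n$. It has this meaning for
  $m \ge 1$ only. Sequences are extensional functions, so that each one is counted once.\<close>

definition Q_indices :: "nat \<Rightarrow> nat \<Rightarrow> nat \<Rightarrow> ((nat \<Rightarrow> nat) \<times> (nat \<Rightarrow> nat)) set" where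
  "Q_indices n m j =
     {(is, js). is \<in> {1..m} \<rightarrow>\<^sub>E {1..n} \<and> js \<in> {1..m} \<rightarrow>\<^sub>E {1..n} \<and> js 1 = j \<and>
                (\<forall>r\<in>{1..m}. js r \<le> is r) \<and> (\<forall>r\<in>{1..<m}. is r < js (r + 1))}"

definition Qfun :: "real mat \<Rightarrow> nat \<Rightarrow> nat \<Rightarrow> nat \<Rightarrow> real" where
  "Qfun H n m j = (\<Sum>(is, js)\<in>Q_indices n m j. \<Prod>r=1..m. entry H (is r) (js r))"

end

theory Submission
  imports Defs
begin

text \<open>Put $n = N - 1$ and let $T(m, i) = \sum_{j > i} Q(n, m, j)$ for $m \ge 1$ and $T(0, i) = 1$.
  Splitting off the first pair of indices gives
  $Q(n, m + 1, j) = \sum_{i=j}^n h_{i,j} T(m, i)$. For prescribed Q-functions $T$ is known, so the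
  $j$-th column of $H$ solves a linear system; it is triangular, because $T(m, i) = 0$ for
  $m > n - i$, with diagonal entries $T(n - i, i) \neq 0$. For the given Q-functions $T$ has a
  closed form by Pascal's rule, and the claimed entries solve the system because
  the partial sums of $h_{i,j} T(m, i)$ telescope.\<close>

section \<open>The recursion for the Q-functions\<close>

text \<open>Restricting to \<open>{1..Suc m}\<close> keeps sequences extensional, so prepending and
  dropping the first term are inverse to each other as functions and not merely on the index
  range.\<close>

definition seq_cons :: "nat \<Rightarrow> nat \<Rightarrow> (nat \<Rightarrow> nat) \<Rightarrow> nat \<Rightarrow> nat" where
  "seq_cons m x f = (\<lambda>r\<in>{1..Suc m}. if r = 1 then x else f (r - 1))"

definition seq_tl :: "nat \<Rightarrow> (nat \<Rightarrow> nat) \<Rightarrow> nat \<Rightarrow> nat" where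
  "seq_tl m f = (\<lambda>r\<in>{1..m}. f (Suc r))"

lemma seq_cons_simps [simp]:
  "seq_cons m x f (Suc 0) = x"
  "1 \<le> r \<Longrightarrow> r \<le> m \<Longrightarrow> seq_cons m x f (Suc r) = f r"
  by (auto simp: seq_cons_def)

lemma seq_tl_cons: "f \<in> {1..m} \<rightarrow>\<^sub>E A \<Longrightarrow> seq_tl m (seq_cons m x f) = f"
  by (fastforce simp: seq_tl_def seq_cons_def PiE_def extensional_def)

lemma seq_cons_tl: "f \<in> {1..Suc m} \<rightarrow>\<^sub>E A \<Longrightarrow> seq_cons m (f 1) (seq_tl m f) = f"
  by (rule ext) (auto simp: seq_tl_def seq_cons_def PiE_def extensional_def)

lemma seq_cons_PiE:
  "f \<in> {1..m} \<rightarrow>\<^sub>E A \<Longrightarrow> x \<in> A \<Longrightarrow> seq_cons m x f \<in> {1..Suc m} \<rightarrow>\<^sub>E A"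
  by (fastforce simp: seq_cons_def PiE_def Pi_def)

lemma seq_tl_PiE: "f \<in> {1..Suc m} \<rightarrow>\<^sub>E A \<Longrightarrow> seq_tl m f \<in> {1..m} \<rightarrow>\<^sub>E A"
  by (auto simp: seq_tl_def PiE_def Pi_def)

text \<open>The hypothesis \<open>i < j'\<close> becomes the link i(1) < j(2) between the new pair
  and the former first pair; the constraints on the old pairs only shift by one.\<close>

lemma Q_indices_cons:
  assumes "1 \<le> m" "1 \<le> j" "j \<le> i" "i \<le> n" "i < j'" "(f, g) \<in> Q_indices n m j'"
  shows "(seq_cons m i f, seq_cons m j g) \<in> Q_indices n (Suc m) j"
proof -
  from assms(6) have f: "f \<in> {1..m} \<rightarrow>\<^sub>E {1..n}" and g: "g \<in> {1..m} \<rightarrow>\<^sub>E {1..n}"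
    and g1: "g 1 = j'" and le: "\<And>r. r \<in> {1..m} \<Longrightarrow> g r \<le> f r"
    and lt: "\<And>r. r \<in> {1..<m} \<Longrightarrow> f r < g (r + 1)"
    by (auto simp: Q_indices_def)
  have "seq_cons m j g r \<le> seq_cons m i f r" if "r \<in> {1..Suc m}" for r
    using that assms(3) le[of "r - 1"] by (cases "r = 1") (auto simp: seq_cons_def le_diff_conv2)
  moreover have "seq_cons m i f r < seq_cons m j g (r + 1)" if "r \<in> {1..<Suc m}" for r
    using that assms(5) g1 lt[of "r - 1"]
    by (cases "r = 1") (auto simp: seq_cons_def le_diff_conv2)
  moreover have "seq_cons m i f \<in> {1..Suc m} \<rightarrow>\<^sub>E {1..n}" "seq_cons m j g \<in> {1..Suc m} \<rightarrow>\<^sub>E {1..n}"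
    using assms f g by (auto intro!: seq_cons_PiE simp del: One_nat_def)
  ultimately show ?thesis
    by (simp add: Q_indices_def)
qed

lemma Q_indices_tl:
  assumes "1 \<le> m" "(f, g) \<in> Q_indices n (Suc m) j"
  shows "f 1 \<in> {j..n}" "g 2 \<in> {Suc (f 1)..n}" "(seq_tl m f, seq_tl m g) \<in> Q_indices n m (g 2)"
proof -
  from assms(2) have f: "f \<in> {1..Suc m} \<rightarrow>\<^sub>E {1..n}" and g: "g \<in> {1..Suc m} \<rightarrow>\<^sub>E {1..n}"
    and g1: "g 1 = j" and le: "\<And>r. r \<in> {1..Suc m} \<Longrightarrow> g r \<le> f r"
    and lt: "\<And>r. r \<in> {1..<Suc m} \<Longrightarrow> f r < g (r + 1)"
    by (auto simp: Q_indices_def)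
  have fn: "f 1 \<in> {1..n}" by (rule PiE_mem[OF f]) simp
  have gn: "g 2 \<in> {1..n}" by (rule PiE_mem[OF g]) (use assms in simp)
  show "f 1 \<in> {j..n}" using fn le[of 1] g1 by simp
  show "g 2 \<in> {Suc (f 1)..n}" using gn lt[of 1] assms(1) by (simp add: numeral_2_eq_2)
  have "seq_tl m g r \<le> seq_tl m f r" if "r \<in> {1..m}" for r
    using that le[of "Suc r"] by (simp add: seq_tl_def)
  moreover have "seq_tl m f r < seq_tl m g (r + 1)" if "r \<in> {1..<m}" for r
    using that lt[of "Suc r"] by (simp add: seq_tl_def)
  ultimately show "(seq_tl m f, seq_tl m g) \<in> Q_indices n m (g 2)"
    using seq_tl_PiE[OF f] seq_tl_PiE[OF g] assms(1)
    by (simp add: Q_indices_def) (simp add: seq_tl_def numeral_2_eq_2)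
qed

section \<open>Recursion in the length of the index sequences\<close>

lemma finite_Q_indices: "finite (Q_indices n m j)"
proof (rule finite_subset)
  show "Q_indices n m j \<subseteq> ({1..m} \<rightarrow>\<^sub>E {1..n}) \<times> ({1..m} \<rightarrow>\<^sub>E {1..n})"
    by (auto simp: Q_indices_def)
qed (auto intro!: finite_PiE)

lemma prod_atLeast1_Suc:
  fixes c :: "nat \<Rightarrow> 'a::comm_monoid_mult"
  shows "(\<Prod>r=1..Suc m. c r) = c 1 * (\<Prod>r=1..m. c (Suc r))"
  using prod.atLeast_Suc_atMost[of 1 "Suc m" c] prod.shift_bounds_cl_Suc_ivl[of c 1 m] by simp

lemma Qfun_Suc:
  assumes "1 \<le> m" "j \<in> {1..n}"
  shows "Qfun H n (Suc m) j = (\<Sum>i=j..n. entry H i j * (\<Sum>j'=Suc i..n. Qfun H n m j'))"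
proof -
  let ?w = "\<lambda>m (f, g). \<Prod>r=1..m. entry H (f r) (g r)"
  \<comment> \<open>A sequence of m + 1 pairs is encoded by i(1), j(2) and the remaining m pairs;
    recording j(2) separately matches the inner sum over starting points \<open>j'\<close>.\<close>
  let ?S = "SIGMA i:{j..n}. SIGMA j':{Suc i..n}. Q_indices n m j'"
  have "Qfun H n (Suc m) j = sum (?w (Suc m)) (Q_indices n (Suc m) j)"
    by (simp add: Qfun_def)
  also have "\<dots> = (\<Sum>(i, j', p)\<in>?S. entry H i j * ?w m p)"
  proof (rule sum.reindex_bij_witness[where
        i = "\<lambda>(i, j', f, g). (seq_cons m i f, seq_cons m j g)" and
        j = "\<lambda>(f, g). (f 1, g 2, seq_tl m f, seq_tl m g)"])
    fix p assume p: "p \<in> Q_indices n (Suc m) j"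
    obtain f g where fg: "p = (f, g)" by force
    have *: "f \<in> {1..Suc m} \<rightarrow>\<^sub>E {1..n}" "g \<in> {1..Suc m} \<rightarrow>\<^sub>E {1..n}" "g 1 = j"
      using p by (auto simp: fg Q_indices_def)
    show "(case case p of (f, g) \<Rightarrow> (f 1, g 2, seq_tl m f, seq_tl m g) of
        (i, j', f, g) \<Rightarrow> (seq_cons m i f, seq_cons m j g)) = p"
      using seq_cons_tl[OF *(1)] seq_cons_tl[OF *(2)] *(3) by (simp add: fg)
    show "(case p of (f, g) \<Rightarrow> (f 1, g 2, seq_tl m f, seq_tl m g)) \<in> ?S"
      using Q_indices_tl[OF assms(1) p[unfolded fg]] by (simp add: fg)
    have "(\<Prod>r=1..m. entry H (f (Suc r)) (g (Suc r))) =
        (\<Prod>r=1..m. entry H (seq_tl m f r) (seq_tl m g r))"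
      by (rule prod.cong) (auto simp: seq_tl_def)
    then show "(case case p of (f, g) \<Rightarrow> (f 1, g 2, seq_tl m f, seq_tl m g) of
        (i, j', p) \<Rightarrow> entry H i j * ?w m p) = ?w (Suc m) p"
      unfolding fg prod.case prod_atLeast1_Suc *(3) by simp
  next
    fix s assume s: "s \<in> ?S"
    obtain i j' f g where fg: "s = (i, j', f, g)" by (metis prod.exhaust)
    have s': "i \<in> {j..n}" "j' \<in> {Suc i..n}" "(f, g) \<in> Q_indices n m j'"
      using s by (auto simp: fg)
    have *: "f \<in> {1..m} \<rightarrow>\<^sub>E {1..n}" "g \<in> {1..m} \<rightarrow>\<^sub>E {1..n}" "g 1 = j'"
      using s' by (auto simp: Q_indices_def)
    show "(case case s of (i, j', f, g) \<Rightarrow> (seq_cons m i f, seq_cons m j g) of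
        (f, g) \<Rightarrow> (f 1, g 2, seq_tl m f, seq_tl m g)) = s"
      using seq_tl_cons[OF *(1)] seq_tl_cons[OF *(2)] *(3) assms(1)
      by (simp add: fg numeral_2_eq_2)
    show "(case s of (i, j', f, g) \<Rightarrow> (seq_cons m i f, seq_cons m j g)) \<in> Q_indices n (Suc m) j"
      using Q_indices_cons[OF assms(1) _ _ _ _ s'(3)] s' assms(2) by (simp add: fg)
  qed
  also have "\<dots> = (\<Sum>i=j..n. \<Sum>j'=Suc i..n. \<Sum>p\<in>Q_indices n m j'. entry H i j * ?w m p)"
    by (simp add: sum.Sigma finite_Q_indices finite_SigmaI split_def)
  also have "\<dots> = (\<Sum>i=j..n. entry H i j * (\<Sum>j'=Suc i..n. Qfun H n m j'))"
    by (simp add: Qfun_def sum_distrib_left)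
  finally show ?thesis .
qed

text \<open>The recursion starts at m = 1, since \<open>Q_indices\<close> has its intended meaning
  only from there; this case corresponds to the convention T(0, i) = 1.\<close>

lemma Qfun_1:
  assumes "j \<in> {1..n}"
  shows "Qfun H n 1 j = (\<Sum>i=j..n. entry H i j)"
  unfolding Qfun_def
proof (rule sum.reindex_bij_witness[where
      j = "\<lambda>(f, g). f 1" and i = "\<lambda>i. (\<lambda>r\<in>{1}. i, \<lambda>r\<in>{1}. j)"])
  fix p assume p: "p \<in> Q_indices n 1 j"
  obtain f g where fg: "p = (f, g)" by force
  have *: "f \<in> {1} \<rightarrow>\<^sub>E {1..n}" "g \<in> {1} \<rightarrow>\<^sub>E {1..n}" "g 1 = j" "j \<le> f 1"
    using p by (auto simp: fg Q_indices_def)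
  show "(\<lambda>r\<in>{1}. case p of (f, g) \<Rightarrow> f 1, \<lambda>r\<in>{1}. j) = p"
    using * by (auto simp: fg PiE_def extensional_def fun_eq_iff)
  show "(case p of (f, g) \<Rightarrow> f 1) \<in> {j..n}"
    using PiE_mem[OF *(1), of 1] *(4) by (simp add: fg)
  show "entry H (case p of (f, g) \<Rightarrow> f 1) j = (case p of (f, g) \<Rightarrow> \<Prod>r=1..1. entry H (f r) (g r))"
    using *(3) by (simp add: fg)
next
  fix i assume "i \<in> {j..n}"
  then show "(\<lambda>r\<in>{1}. i, \<lambda>r\<in>{1}. j) \<in> Q_indices n 1 j"
    using assms by (auto simp: Q_indices_def)
qed simp

text \<open>The j(r) increase strictly from j, so m pairs need j + m - 1 \<le> n. In the induction
  all inner sums of the recursion vanish.\<close>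

lemma Qfun_eq_0:
  assumes "j \<in> {1..n}" "1 \<le> m" "n < m + j - 1"
  shows "Qfun H n m j = 0"
  using assms(2,1,3)
proof (induction m arbitrary: j rule: nat_induct_at_least)
  case base
  then show ?case by simp
next
  case (Suc m)
  have "(\<Sum>j'=Suc i..n. Qfun H n m j') = 0" if "i \<in> {j..n}" for i
    using that Suc.prems by (intro sum.neutral ballI Suc.IH) auto
  then show ?case using Suc.hyps Suc.prems by (simp add: Qfun_Suc)
qed

section \<open>Triangular linear systems for the columns\<close>

text \<open>\<open>T\<close> is built from the prescribed values \<open>q\<close> and not from
  \<open>H\<close>, so the right-hand side is linear in \<open>H\<close>. Both Q and
  \<open>q\<close> vanish beyond k = n + 1 - j, which lets m range over all naturals. For the
  converse, the equation with m = k lifts equality at length k to length k + 1.\<close>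

lemma Qfun_eq_iff:
  fixes q T :: "nat \<Rightarrow> nat \<Rightarrow> real"
  assumes T0: "\<And>i. i \<le> n \<Longrightarrow> T 0 i = 1"
    and T: "\<And>m i. 1 \<le> m \<Longrightarrow> 1 \<le> i \<Longrightarrow> i \<le> n \<Longrightarrow> T m i = (\<Sum>j=Suc i..n. q m j)"
    and q0: "\<And>m j. j \<in> {1..n} \<Longrightarrow> n < m + j - 1 \<Longrightarrow> q m j = 0"
  shows "(\<forall>j\<in>{1..n}. \<forall>k\<in>{1..Suc n - j}. Qfun H n k j = q k j) \<longleftrightarrow>
    (\<forall>j\<in>{1..n}. \<forall>m. (\<Sum>i=j..n. entry H i j * T m i) = q (Suc m) j)" (is "?L \<longleftrightarrow> ?R")
proof
  assume ?L
  then have Q: "Qfun H n k j = q k j" if "j \<in> {1..n}" "1 \<le> k" for k j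
    using that Qfun_eq_0[of j n k H] q0[of j k] by (cases "k \<le> Suc n - j") auto
  show ?R
  proof (intro ballI allI)
    fix j m assume j: "j \<in> {1..n}"
    show "(\<Sum>i=j..n. entry H i j * T m i) = q (Suc m) j"
    proof (cases "m = 0")
      case True
      then show ?thesis using Q[OF j, of 1] Qfun_1[OF j, of H] by (simp add: T0)
    next
      case False
      then show ?thesis using Q[OF j, of "Suc m"] Qfun_Suc[OF _ j, of m H] j
        by (simp add: T Q)
    qed
  qed
next
  assume R: ?R
  have "Qfun H n k j = q k j" if "1 \<le> k" "j \<in> {1..n}" for k j
    using that
  proof (induction k arbitrary: j rule: nat_induct_at_least)
    case base
    then show ?case using R[rule_format, OF base, of 0] Qfun_1[OF base, of H] by (simp add: T0)
  next
    case (Suc k)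
    then show ?case using R[rule_format, OF Suc.prems, of k] by (simp add: Qfun_Suc T)
  qed
  then show ?L by simp
qed

text \<open>Forward substitution: in the equation with m = n - i the unknowns after i have
  coefficient 0 and those before i are 0 by induction, which leaves \<open>x i\<close> times a
  nonzero coefficient.\<close>

lemma triangular_system_zero:
  fixes T :: "nat \<Rightarrow> nat \<Rightarrow> real"
  assumes T0: "\<And>m i. i \<in> {j..n} \<Longrightarrow> n < m + i \<Longrightarrow> T m i = 0"
    and Td: "\<And>i. i \<in> {j..n} \<Longrightarrow> T (n - i) i \<noteq> 0"
    and x: "\<And>m. (\<Sum>i=j..n. x i * T m i) = 0"
    and i: "i \<in> {j..n}"
  shows "x i = 0"
  using i
proof (induction i rule: less_induct)
  case (less i)
  have "x k * T (n - i) k = 0" if "k \<in> {j..n} - {i}" for k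
  proof (cases "k < i")
    case True
    then show ?thesis using that less.IH by simp
  next
    case False
    then have "n < n - i + k" using that less.prems by auto
    then show ?thesis using that T0[of k "n - i"] by simp
  qed
  then have "(\<Sum>k\<in>{j..n} - {i}. x k * T (n - i) k) = 0"
    by (intro sum.neutral ballI)
  then have "(\<Sum>k=j..n. x k * T (n - i) k) = x i * T (n - i) i"
    using less.prems by (simp add: sum.remove[of _ i])
  then show ?case using x[of "n - i"] Td[OF less.prems] by simp
qed

text \<open>Summation from the right end: the closed forms below are verified by supplying an
  antidifference \<open>F\<close> that vanishes at n.\<close>

lemma sum_tail_telescope:
  fixes f F :: "nat \<Rightarrow> 'a::comm_monoid_add"
  assumes "i \<le> n" "F n = 0" "\<And>k. i \<le> k \<Longrightarrow> k < n \<Longrightarrow> F k = f (Suc k) + F (Suc k)"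
  shows "(\<Sum>k=Suc i..n. f k) = F i"
  using assms(1)
proof (induction i rule: inc_induct)
  case base
  then show ?case using assms(2) by simp
next
  case (step k)
  then show ?case using assms(3)[of k] by (simp add: sum.atLeast_Suc_atMost[of "Suc k"])
qed

section \<open>The explicit solution\<close>

text \<open>Here n = N - 1 and a = N', so \<open>real n - real a + 2\<close> is N - N' + 1.\<close>

definition q_val :: "nat \<Rightarrow> nat \<Rightarrow> nat \<Rightarrow> nat \<Rightarrow> real" where
  "q_val n a k j =
     (if j < a then 1 / (real k + 1) * real ((n - j) choose (k - 1))
      else (real j - real a + 1) / (real n - real a + 2) * real ((n - j) choose (k - 1)))"

text \<open>For i \<ge> a, split j - a + 1 = (i - a + 1) + (j - i) in the tail sum over j > i; the
  two parts are a hockey-stick sum and an iterated one.\<close>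

definition tail_val :: "nat \<Rightarrow> nat \<Rightarrow> nat \<Rightarrow> nat \<Rightarrow> real" where
  "tail_val n a m i =
     (if i < a then real ((n - i) choose m) / (real m + 1)
      else ((real i - real a + 1) * real ((n - i) choose m) + real (Suc (n - i) choose Suc m))
        / (real n - real a + 2))"

text \<open>Intended for j \<le> k, where the tests separate, in this order, the lower right
  triangle, the lower left rectangle and the upper left triangle.\<close>

definition h_val :: "nat \<Rightarrow> nat \<Rightarrow> nat \<Rightarrow> nat \<Rightarrow> real" where
  "h_val n a k j =
     (if a \<le> j then
        if j = k then (real k - real a + 1) / (real k - real a + 2)
        else - (real j - real a + 1) / ((real k - real a + 1) * (real k - real a + 2))
      else if a \<le> k then
        - (real n - real a + 2) / (2 * (real n + 1 - real j) * (real n + 2 - real j))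
      else if j = k then (real n + 1 - real k) / (real n + 2 - real k)
      else - (real n + 1 - real k) / ((real n + 1 - real j) * (real n + 2 - real j)))"

section \<open>Binomial identities and tail sums\<close>

lemma Suc_binomial_real:
  "real (Suc s choose Suc m) = real (s choose m) * (real s + 1) / (real m + 1)"
  using arg_cong[OF Suc_times_binomial_eq[of s m], of real]
  by (simp add: field_simps del: binomial_Suc_Suc)

text \<open>The subtraction is in the reals: for s < m the factor s - m is negative, but then
  \<open>s choose m\<close> is 0.\<close>

lemma binomial_Suc_real:
  "real (s choose Suc m) = real (s choose m) * (real s - real m) / (real m + 1)"
proof -
  have "real (s choose Suc m) = real (Suc s choose Suc m) - real (s choose m)" by simp
  then show ?thesis unfolding Suc_binomial_real by (simp add: field_simps)
qed

lemma tail_val_0: "i \<le> n \<Longrightarrow> a \<le> n \<Longrightarrow> tail_val n a 0 i = 1"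
  by (auto simp: tail_val_def of_nat_diff)

lemma tail_val_step:
  assumes "k < n" "a \<le> n" "1 \<le> m"
  shows "tail_val n a m k = q_val n a m (Suc k) + tail_val n a m (Suc k)"
proof -
  obtain l where m: "m = Suc l" using assms(3) by (cases m) auto
  define s where "s = n - Suc k"
  have s: "n - k = Suc s" "n - Suc k = s" "n = Suc (k + s)" using assms by (auto simp: s_def)
  show ?thesis
  proof (cases "k < a")
    case False
    then show ?thesis unfolding tail_val_def q_val_def s(1,2) m
      by (simp add: add_divide_distrib[symmetric]) (simp add: algebra_simps)
  next
    case True
    show ?thesis
    proof (cases "Suc k < a")
      case True
      then show ?thesis unfolding tail_val_def q_val_def s m
        by (simp add: add_divide_distrib[symmetric] add.commute)
    next
      case False
      with True have a: "a = Suc k" by simp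
      have "real (Suc s choose Suc l) + real (Suc s choose Suc (Suc l)) =
          real (Suc (Suc s) choose Suc (Suc l))" by simp
      then have "(real (s choose l) + real (s choose Suc l) + real (Suc s choose Suc (Suc l))) / (real s + 2)
          = real (Suc s choose Suc l) / (real l + 2)"
        by (simp add: Suc_binomial_real[of "Suc s" "Suc l"] field_simps del: binomial_Suc_Suc)
           (simp add: field_simps)
      then show ?thesis unfolding tail_val_def q_val_def s m a
        by (simp add: add_divide_distrib add.assoc del: binomial_Suc_Suc)
    qed
  qed
qed

lemma tail_val_end: "1 \<le> m \<Longrightarrow> tail_val n a m n = 0"
  by (cases m) (auto simp: tail_val_def)

lemma sum_q_val:
  assumes "a \<le> n" "1 \<le> m" "i \<le> n"
  shows "(\<Sum>j=Suc i..n. q_val n a m j) = tail_val n a m i"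
  using assms by (intro sum_tail_telescope tail_val_end tail_val_step)

section \<open>Verification of the column equations\<close>

text \<open>With b = j - a + 1, the entries below the diagonal are b (1/(i-a+2) - 1/(i-a+1)).
  Summation by parts against T, whose decrement at i contains the factor i - a + 1, produces
  \<open>?F\<close>. The diagonal entry b/(b+1) then cancels the T-term of
  \<open>?F j\<close>.\<close>

lemma h_val_column_large:
  assumes "a \<le> j" "j \<le> n"
  shows "(\<Sum>i=j..n. h_val n a i j * tail_val n a m i) = q_val n a (Suc m) j"
proof -
  let ?b = "real j - real a + 1"
  let ?M = "real n - real a + 2"
  let ?F = "\<lambda>i. ?b * (real ((n - i) choose m) / ?M - tail_val n a m i / (real i - real a + 2))"
  have "(\<Sum>i=Suc j..n. h_val n a i j * tail_val n a m i) = ?F j"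
  proof (rule sum_tail_telescope[where F = ?F])
    have "?M > 0" using assms by simp
    then show "?F n = 0" using assms by (cases m) (auto simp: tail_val_def field_simps)
    fix k assume k: "j \<le> k" "k < n"
    define s where "s = n - Suc k"
    have s: "n - k = Suc s" "n - Suc k = s" using k by (auto simp: s_def)
    define c where "c = real k - real a + 2"
    have c: "c > 0" "?M > 0" using k assms by (auto simp: c_def)
    \<comment> \<open>A difference of binomials, instead of the coefficient with lower index m - 1,
      also covers m = 0, where both sides are 0.\<close>
    have "tail_val n a m k - tail_val n a m (Suc k) =
        c * (real (Suc s choose m) - real (s choose m)) / ?M"
    proof (cases m)
      case 0
      then show ?thesis using k assms by (simp add: tail_val_0)
    next
      case (Suc l)
      then show ?thesis
        using tail_val_step[of k n a m] k assms by (simp add: q_val_def s c_def)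
    qed
    then have *: "tail_val n a m k = tail_val n a m (Suc k) +
        c * (real (Suc s choose m) - real (s choose m)) / ?M" by simp
    have h: "h_val n a (Suc k) j = - ?b / (c * (c + 1))"
      using k assms by (simp add: h_val_def c_def algebra_simps)
    have e: "real (Suc k) - real a + 2 = c + 1" by (simp add: c_def)
    show "?F k = h_val n a (Suc k) j * tail_val n a m (Suc k) + ?F (Suc k)"
      unfolding s * h e c_def[symmetric] using c
      by (simp add: divide_simps) (simp add: algebra_simps)
  qed (use assms in simp)
  moreover have "h_val n a j j = ?b / (?b + 1)" "?b + 1 > 0" "?M > 0"
    using assms by (auto simp: h_val_def)
  moreover have "real j - real a + 2 = ?b + 1" by simp
  ultimately show ?thesis using assms
    by (simp add: sum.atLeast_Suc_atMost[of j] q_val_def right_diff_distrib)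
qed

text \<open>For i < a, absorption turns (n+1-i) T(m, i) into the coefficient of n-i+1 over m+1, a
  hockey-stick summand. The factor 1/2 in the entries with i \<ge> a makes their total exactly the
  value at which this hockey-stick sum continues.\<close>

lemma h_val_column_small:
  assumes "j < a" "a \<le> n"
  shows "(\<Sum>i=j..n. h_val n a i j * tail_val n a m i) = q_val n a (Suc m) j"
proof -
  let ?M = "real n - real a + 2"
  define s where "s = n - j"
  have s: "real n + 1 - real j = real s + 1" "real n + 2 - real j = real s + 2" "n - j = s"
    using assms by (auto simp: s_def)
  define D where "D = (real s + 1) * (real s + 2)"
  have D: "D > 0" by (simp add: D_def)
  have M: "?M > 0" using assms by simp
  \<comment> \<open>In the second branch both parts of (n-a+2) T(m, k) contribute the same
    coefficient when summed over k > i, hence the 2.\<close>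
  let ?F = "\<lambda>i. - (if i < a then real (Suc (n - i) choose Suc (Suc m))
      else ((real i - real a + 1) * real ((n - i) choose Suc m) +
        2 * real (Suc (n - i) choose Suc (Suc m))) / 2) / D"
  have "(\<Sum>i=Suc j..n. h_val n a i j * tail_val n a m i) = ?F j"
  proof (rule sum_tail_telescope[where F = ?F])
    show "?F n = 0" using assms by auto
    fix k assume k: "j \<le> k" "k < n"
    define t where "t = n - Suc k"
    have t: "n - k = Suc t" "n - Suc k = t" "n = Suc (k + t)" using k by (auto simp: t_def)
    show "?F k = h_val n a (Suc k) j * tail_val n a m (Suc k) + ?F (Suc k)"
    proof (cases "Suc k < a")
      case True
      have h: "h_val n a (Suc k) j = - (real t + 1) / D"
        using k True unfolding h_val_def s D_def by (simp add: t(3))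
      have "(real t + 1) * tail_val n a m (Suc k) = real (Suc t choose Suc m)"
        using True by (simp add: tail_val_def t(2) Suc_binomial_real field_simps del: binomial_Suc_Suc)
      then have "h_val n a (Suc k) j * tail_val n a m (Suc k) = - real (Suc t choose Suc m) / D"
        by (simp only: h times_divide_eq_left mult_minus_left)
      then show ?thesis using True D unfolding t by (simp add: field_simps)
    next
      case False
      have h: "h_val n a (Suc k) j = - ?M / (2 * D)"
        using k False assms unfolding h_val_def s D_def by (simp add: algebra_simps)
      have "?M * tail_val n a m (Suc k) = (real k - real a + 2) * real (t choose m) + real (Suc t choose Suc m)"
        using False M by (simp add: tail_val_def t(2))
      then have *: "h_val n a (Suc k) j * tail_val n a m (Suc k) =
         - ((real k - real a + 2) * real (t choose m) + real (Suc t choose Suc m)) / (2 * D)"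
        by (simp only: h times_divide_eq_left mult_minus_left)
      \<comment> \<open>The range includes i = a - 1, where i - a + 1 = 0 makes the branches agree;
        the step from k = a - 1 to a needs this.\<close>
      have F: "?F i = - ((real i - real a + 1) * real ((n - i) choose Suc m) +
          2 * real (Suc (n - i) choose Suc (Suc m))) / (2 * D)" if "a \<le> Suc i" for i
      proof (cases "i < a")
        case True
        with that have "real i - real a + 1 = 0" by simp
        then show ?thesis using True D by (simp add: field_simps)
      next
        case False
        then show ?thesis using D by (simp add: field_simps)
      qed
      have "a \<le> Suc k" "a \<le> Suc (Suc k)" using False by auto
      then show ?thesis unfolding F[OF \<open>a \<le> Suc k\<close>] F[OF \<open>a \<le> Suc (Suc k)\<close>] *
          unfolding t(1,2)
        using D by (simp add: divide_simps) (simp add: algebra_simps)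
    qed
  qed (use assms in simp)
  moreover have "h_val n a j j = (real s + 1) / (real s + 2)"
    using assms unfolding h_val_def s by simp
  \<comment> \<open>The diagonal term plus \<open>?F j\<close>. In terms of
    \<open>s choose m\<close> this reduces to (s+1)(m+2) - (s-m) = (s+2)(m+1).\<close>
  moreover have "(real s + 1) / (real s + 2) * (real (s choose m) / (real m + 1)) -
      real (Suc s choose Suc (Suc m)) / D = real (s choose m) / (real m + 2)"
    unfolding Suc_binomial_real[of s "Suc m"] binomial_Suc_real[of s m] D_def
    by (simp add: divide_simps) (simp add: algebra_simps)
  ultimately show ?thesis using assms
    by (simp add: sum.atLeast_Suc_atMost[of j] q_val_def tail_val_def s del: binomial_Suc_Suc)
qed

lemma h_val_column:
  assumes "j \<le> n" "a \<le> n"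
  shows "(\<Sum>i=j..n. h_val n a i j * tail_val n a m i) = q_val n a (Suc m) j"
  using assms h_val_column_large h_val_column_small by (cases "a \<le> j") auto

section \<open>Existence and uniqueness of the matrix\<close>

lemma Qfun_eq_q_val_iff:
  assumes "a \<le> n"
  shows "(\<forall>j\<in>{1..n}. \<forall>k\<in>{1..Suc n - j}. Qfun H n k j = q_val n a k j) \<longleftrightarrow>
    (\<forall>j\<in>{1..n}. \<forall>i\<in>{j..n}. entry H i j = h_val n a i j)" (is "?L \<longleftrightarrow> ?R")
proof -
  have "?L \<longleftrightarrow> (\<forall>j\<in>{1..n}. \<forall>m. (\<Sum>i=j..n. entry H i j * tail_val n a m i) = q_val n a (Suc m) j)"
    using assms
    by (intro Qfun_eq_iff) (simp_all add: tail_val_0 sum_q_val, auto simp: q_val_def)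
  also have "\<dots> \<longleftrightarrow> ?R"
  proof
    assume L: "\<forall>j\<in>{1..n}. \<forall>m. (\<Sum>i=j..n. entry H i j * tail_val n a m i) = q_val n a (Suc m) j"
    show ?R
    proof (intro ballI)
      fix j i assume j: "j \<in> {1..n}" and i: "i \<in> {j..n}"
      \<comment> \<open>The difference of two solutions of the column system solves the homogeneous
        one.\<close>
      have "entry H i j - h_val n a i j = 0"
      proof (rule triangular_system_zero[where T = "tail_val n a" and j = j and n = n
            and x = "\<lambda>i. entry H i j - h_val n a i j"])
        show "(\<Sum>i=j..n. (entry H i j - h_val n a i j) * tail_val n a m i) = 0" for m
          using L j h_val_column[of j n a m] assms
          by (simp add: left_diff_distrib sum_subtractf)
        show "tail_val n a m i = 0" if "i \<in> {j..n}" "n < m + i" for m i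
          using that by (auto simp: tail_val_def binomial_eq_0)
        \<comment> \<open>The value is 1/(n-i+1) for i < a and (i-a+2)/(n-a+2) otherwise.\<close>
        show "tail_val n a (n - i) i \<noteq> 0" if "i \<in> {j..n}" for i
          using that assms by (auto simp: tail_val_def simp del: binomial_Suc_Suc)
      qed (rule i)
      then show "entry H i j = h_val n a i j" by simp
    qed
  next
    assume R: ?R
    show "\<forall>j\<in>{1..n}. \<forall>m. (\<Sum>i=j..n. entry H i j * tail_val n a m i) = q_val n a (Suc m) j"
    proof (intro ballI allI)
      fix j m assume j: "j \<in> {1..n}"
      have "(\<Sum>i=j..n. entry H i j * tail_val n a m i) = (\<Sum>i=j..n. h_val n a i j * tail_val n a m i)"
        using R j by (intro sum.cong) auto
      then show "(\<Sum>i=j..n. entry H i j * tail_val n a m i) = q_val n a (Suc m) j"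
        using j assms by (simp add: h_val_column)
    qed
  qed
  finally show ?thesis .
qed

lemma ex1_lower_triangular_nz:
  fixes h :: "nat \<Rightarrow> nat \<Rightarrow> real"
  assumes "\<And>j. j \<in> {1..n} \<Longrightarrow> h j j \<noteq> 0"
  shows "\<exists>!H. lower_triangular_nz n H \<and> (\<forall>j\<in>{1..n}. \<forall>i\<in>{j..n}. entry H i j = h i j)"
proof (rule ex1I)
  let ?H = "mat n n (\<lambda>(r, c). if c \<le> r then h (Suc r) (Suc c) else 0)"
  show "lower_triangular_nz n ?H \<and> (\<forall>j\<in>{1..n}. \<forall>i\<in>{j..n}. entry ?H i j = h i j)"
    using assms by (auto simp: lower_triangular_nz_def entry_def upper_triangular_def)
  fix H assume H: "lower_triangular_nz n H \<and> (\<forall>j\<in>{1..n}. \<forall>i\<in>{j..n}. entry H i j = h i j)"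
  then have dim: "H \<in> carrier_mat n n" and ut: "upper_triangular (transpose_mat H)"
    by (auto simp: lower_triangular_nz_def)
  show "H = ?H"
  proof (rule eq_matI)
    fix r c assume "r < dim_row ?H" "c < dim_col ?H"
    then have rc: "r < n" "c < n" by auto
    show "H $$ (r, c) = ?H $$ (r, c)"
    proof (cases "c \<le> r")
      case True
      then have "entry H (Suc r) (Suc c) = h (Suc r) (Suc c)" using H rc by auto
      then show ?thesis using True rc by (simp add: entry_def)
    next
      case False
      then have "transpose_mat H $$ (c, r) = 0"
        using ut dim rc unfolding upper_triangular_def by auto
      then show ?thesis using False rc dim by simp
    qed
  qed (use dim in auto)
qed

theorem proposition9:
  fixes N N' :: nat
  assumes "2 \<le> N'" and "N' \<le> N - 2"
  defines "P \<equiv> \<lambda>H. lower_triangular_nz (N - 1) H \<and>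
     (\<forall>j\<in>{1..N - 1}. \<forall>k\<in>{1..N - j}.
        Qfun H (N - 1) k j =
          (if j \<le> N' - 1 then 1 / (real k + 1) * real ((N - j - 1) choose (k - 1))
           else (real j - real N' + 1) / (real N - real N' + 1) * real ((N - j - 1) choose (k - 1))))"
  shows "(\<exists>!H. P H) \<and>
     (\<forall>H. P H \<longrightarrow> (\<forall>k j. 1 \<le> j \<and> j \<le> k \<and> k \<le> N - 1 \<longrightarrow>
        (j = k \<and> k \<le> N' - 1 \<longrightarrow>
           entry H k j = (real N - real k) / (real N - real k + 1)) \<and>
        (j < k \<and> k \<le> N' - 1 \<longrightarrow>
           entry H k j = - (real N - real k) / ((real N - real j) * (real N - real j + 1))) \<and>
        (j = k \<and> N' \<le> k \<longrightarrow>
           entry H k j = (real k - real N' + 1) / (real k - real N' + 2)) \<and>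
        (N' \<le> j \<and> j < k \<longrightarrow>
           entry H k j =
             - (real j - real N' + 1) / ((real k - real N' + 1) * (real k - real N' + 2))) \<and>
        (N' \<le> k \<and> j \<le> N' - 1 \<longrightarrow>
           entry H k j =
             - (real N - real N' + 1) / (2 * (real N - real j) * (real N - real j + 1)))))"
proof -
  define n where "n = N - 1"
  \<comment> \<open>The hypotheses force N \<ge> 4, so N - 1 and N - 2 are not truncated.\<close>
  have n: "N = Suc n" "N' \<le> n" "2 \<le> N'" using assms(1,2) by (auto simp: n_def)
  have "j \<le> N' - 1 \<longleftrightarrow> j < N'" for j using n(3) by auto
  then have P_eq: "P H \<longleftrightarrow> lower_triangular_nz n H \<and>
      (\<forall>j\<in>{1..n}. \<forall>k\<in>{1..Suc n - j}. Qfun H n k j = q_val n N' k j)" for H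
    unfolding P_def n(1) q_val_def by (simp add: algebra_simps)
  then have P: "P H \<longleftrightarrow> lower_triangular_nz n H \<and>
      (\<forall>j\<in>{1..n}. \<forall>i\<in>{j..n}. entry H i j = h_val n N' i j)" for H
    by (simp only: Qfun_eq_q_val_iff[OF n(2)])
  \<comment> \<open>\<open>P\<close> now prescribes exactly the lower triangle. Its diagonal values
    are quotients of positive numbers, hence nonzero.\<close>
  have "\<exists>!H. P H"
    unfolding P by (rule ex1_lower_triangular_nz) (auto simp: h_val_def)
  moreover have "entry H k j = h_val n N' k j" if "P H" "1 \<le> j" "j \<le> k" "k \<le> n" for H k j
    using that by (simp add: P)
  ultimately show ?thesis
    unfolding n(1) using n(3) by (auto simp: h_val_def algebra_simps)
qed

end
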